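(* For every $\kappa$-vertex-connected chordal graph $G$ of order $n$ (with $\kappa \geq 1$), $rc(G) \leq \frac{n}{\kappa} + 3$.
   Context: All graphs are finite, simple and undirected. A graph is chordal if it contains no induced cycle of length greater than $3$. A path is a rainbow path if no two of its edges have the same colour. An edge colouring of a connected graph is a rainbow colouring if every pair of vertices is joined by at least one rainbow path. The rainbow connection number $rc(G)$ of a connected graph $G$ is the minimum number of colours in a rainbow colouring of $G$. A graph is $\kappa$-vertex-connected if its vertex connectivity (the minimum number of vertices whose removal disconnects the graph) is at least $\kappa$. *)

theory Defs
  imports Complex_Main
begin

text \<open>A finite simple undirected graph is given by its vertex set \<open>V\<close> and its set \<open>E\<close> of
  edges, which are two-element subsets of \<open>V\<close>.\<close>

definition simple_graph :: "'a set \<Rightarrow> 'a set set \<Rightarrow> bool" where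
  "simple_graph V E \<longleftrightarrow> finite V \<and> (\<forall>e\<in>E. e \<subseteq> V \<and> card e = 2)"

definition induced_edges :: "'a set set \<Rightarrow> 'a set \<Rightarrow> 'a set set" where
  "induced_edges E S = {e \<in> E. e \<subseteq> S}"

fun path_edges :: "'a list \<Rightarrow> 'a set list" where
  "path_edges (x # y # zs) = {x, y} # path_edges (y # zs)"
| "path_edges _ = []"

definition path_between :: "'a set \<Rightarrow> 'a set set \<Rightarrow> 'a \<Rightarrow> 'a list \<Rightarrow> 'a \<Rightarrow> bool" where
  "path_between V E u p v \<longleftrightarrow>
     p \<noteq> [] \<and> hd p = u \<and> last p = v \<and> distinct p \<and> set p \<subseteq> V \<and> set (path_edges p) \<subseteq> E"

definition connected_graph :: "'a set \<Rightarrow> 'a set set \<Rightarrow> bool" where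
  "connected_graph V E \<longleftrightarrow> V \<noteq> {} \<and> (\<forall>u\<in>V. \<forall>v\<in>V. \<exists>p. path_between V E u p v)"

definition cycle_edges :: "'a list \<Rightarrow> 'a set set" where
  "cycle_edges p = {{p ! i, p ! (Suc i mod length p)} | i. i < length p}"

definition induced_cycle :: "'a set \<Rightarrow> 'a set set \<Rightarrow> 'a list \<Rightarrow> bool" where
  "induced_cycle V E p \<longleftrightarrow>
     length p \<ge> 3 \<and> distinct p \<and> set p \<subseteq> V \<and> induced_edges E (set p) = cycle_edges p"

definition chordal :: "'a set \<Rightarrow> 'a set set \<Rightarrow> bool" where
  "chordal V E \<longleftrightarrow> (\<nexists>p. induced_cycle V E p \<and> length p > 3)"

text \<open>No set of vertices disconnects a complete graph. As usual, the vertex connectivity of the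
  complete graph on \<open>n \<ge> 1\<close> vertices is taken to be \<open>n - 1\<close>, by also admitting sets whose
  removal leaves at most one vertex. For a non-complete graph this does not affect the minimum,
  because deleting all vertices but two non-adjacent ones disconnects it.\<close>

definition vertex_connectivity :: "'a set \<Rightarrow> 'a set set \<Rightarrow> nat" where
  "vertex_connectivity V E =
     (LEAST k. \<exists>S\<subseteq>V. card S = k \<and>
        (\<not> connected_graph (V - S) (induced_edges E (V - S)) \<or> card (V - S) \<le> 1))"

definition vertex_connected :: "nat \<Rightarrow> 'a set \<Rightarrow> 'a set set \<Rightarrow> bool" where
  "vertex_connected k V E \<longleftrightarrow> k \<le> vertex_connectivity V E"

definition rainbow_path :: "('a set \<Rightarrow> 'c) \<Rightarrow> 'a set \<Rightarrow> 'a set set \<Rightarrow> 'a \<Rightarrow> 'a list \<Rightarrow> 'a \<Rightarrow> bool" where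
  "rainbow_path c V E u p v \<longleftrightarrow> path_between V E u p v \<and> distinct (map c (path_edges p))"

definition rainbow_colouring :: "('a set \<Rightarrow> 'c) \<Rightarrow> 'a set \<Rightarrow> 'a set set \<Rightarrow> bool" where
  "rainbow_colouring c V E \<longleftrightarrow> (\<forall>u\<in>V. \<forall>v\<in>V. \<exists>p. rainbow_path c V E u p v)"

text \<open>Colours are natural numbers, which is no restriction as there are finitely many edges. Only
  colours that occur on an edge are counted.\<close>

definition rainbow_connection_number :: "'a set \<Rightarrow> 'a set set \<Rightarrow> nat" where
  "rainbow_connection_number V E =
     (LEAST k. \<exists>c :: 'a set \<Rightarrow> nat. rainbow_colouring c V E \<and> card (c ` E) = k)"

text \<open>The minima above are taken over non-empty sets: the whole of \<open>V\<close> is admissible for the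
  connectivity, and a connected graph has a rainbow colouring. Moreover, connectivity at least one
  implies connectedness.\<close>

lemma set_path_edges_subset: "e \<in> set (path_edges p) \<Longrightarrow> e \<subseteq> set p"
  by (induction p rule: path_edges.induct) auto

lemma distinct_path_edges: "distinct p \<Longrightarrow> distinct (path_edges p)"
  by (induction p rule: path_edges.induct) (auto dest: set_path_edges_subset)

lemma rainbow_colouring_exists:
  assumes "simple_graph V E" and "connected_graph V E"
  shows "\<exists>c :: 'a set \<Rightarrow> nat. rainbow_colouring c V (E :: 'a set set)"
proof -
  have "E \<subseteq> Pow V" and "finite V"
    using assms(1) by (auto simp: simple_graph_def)
  then have "finite E"
    by (meson finite_Pow_iff finite_subset)
  then obtain c :: "'a set \<Rightarrow> nat" where c: "inj_on c E"
    using finite_imp_inj_to_nat_seg by blast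
  have "rainbow_path c V E u p v" if "path_between V E u p v" for u p v
    using that c
    by (auto simp: rainbow_path_def path_between_def distinct_map distinct_path_edges
        intro: inj_on_subset)
  then show ?thesis
    using assms(2) unfolding rainbow_colouring_def connected_graph_def by blast
qed

lemma vertex_connected_imp_connected:
  assumes "simple_graph V E" and "vertex_connected k V E" and "k \<ge> 1"
  shows "connected_graph V E"
proof (rule ccontr)
  assume "\<not> connected_graph V E"
  moreover have "induced_edges E V = E"
    using assms(1) by (auto simp: simple_graph_def induced_edges_def)
  ultimately have "vertex_connectivity V E \<le> 0"
    unfolding vertex_connectivity_def by (intro Least_le exI[of _ "{}"]) auto
  then show False
    using assms(2,3) by (simp add: vertex_connected_def)
qed

end

theory Submission
  imports Defs
begin

text \<open>Grow a set \<open>D\<close> of vertices, starting from a single vertex, together with a rainbow colouring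
  of the graph it induces. If \<open>D\<close> is not dominating, let \<open>C\<close> be a component of the graph that
  remains when \<open>D\<close> and its neighbours are deleted. The neighbourhood \<open>Q\<close> of \<open>C\<close> consists of
  neighbours of \<open>D\<close> and separates \<open>C\<close> from \<open>D\<close>; hence it has at least \<open>\<kappa>\<close> vertices, and by
  chordality it is a clique. One new colour, given to all new edges, makes \<open>D \<union> Q\<close> rainbow
  connected, so a dominating set is reached with at most \<open>(n - 1) / \<kappa>\<close> colours. If \<open>\<kappa> \<ge> 2\<close>, all
  degrees are at least two and three more colours suffice for the edges outside the dominating
  set. If \<open>\<kappa> = 1\<close>, adding single vertices gives \<open>n - 1\<close> colours.\<close>

section \<open>Rainbow connections\<close>

definition adj :: "'a set set \<Rightarrow> ('a \<times> 'a) set" where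
  "adj F = {(x, y). {x, y} \<in> F}"

lemma adj_iff [simp]: "(x, y) \<in> adj F \<longleftrightarrow> {x, y} \<in> F"
  by (simp add: adj_def)

lemma adj_mono: "F \<subseteq> F' \<Longrightarrow> adj F \<subseteq> adj F'"
  by (auto simp: adj_def)

lemma adj_rtrancl_mono: "(u, v) \<in> (adj F)\<^sup>* \<Longrightarrow> F \<subseteq> F' \<Longrightarrow> (u, v) \<in> (adj F')\<^sup>*"
  using rtrancl_mono[OF adj_mono] by blast

lemma adj_rtrancl_sym: "(u, v) \<in> (adj F)\<^sup>* \<Longrightarrow> (v, u) \<in> (adj F)\<^sup>*"
  by (rule symD[OF sym_rtrancl]) (auto simp: sym_def insert_commute)

lemma induced_edges_iff [simp]: "e \<in> induced_edges E S \<longleftrightarrow> e \<in> E \<and> e \<subseteq> S"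
  by (simp add: induced_edges_def)

text \<open>Recording a set of edges instead of a list makes walks as good as paths: the edges of any
  path inside \<open>F\<close> again have distinct colours.\<close>

definition rainbow_connected ::
    "('a set \<Rightarrow> 'c) \<Rightarrow> 'a set set \<Rightarrow> 'c set \<Rightarrow> 'a \<Rightarrow> 'a \<Rightarrow> bool" where
  "rainbow_connected c E K u v \<longleftrightarrow> (\<exists>F\<subseteq>E. inj_on c F \<and> c ` F \<subseteq> K \<and> (u, v) \<in> (adj F)\<^sup>*)"

lemma rainbow_connected_refl: "rainbow_connected c E K u u"
  by (auto simp: rainbow_connected_def intro!: exI[of _ "{}"])

lemma rainbow_connected_edge: "{u, v} \<in> E \<Longrightarrow> c {u, v} \<in> K \<Longrightarrow> rainbow_connected c E K u v"
  by (auto simp: rainbow_connected_def intro!: exI[of _ "{{u, v}}"])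

lemma rainbow_connected_sym: "rainbow_connected c E K u v \<Longrightarrow> rainbow_connected c E K v u"
  by (metis adj_rtrancl_sym rainbow_connected_def)

lemma rainbow_connected_mono:
  "rainbow_connected c E K u v \<Longrightarrow> E \<subseteq> E' \<Longrightarrow> K \<subseteq> K' \<Longrightarrow> rainbow_connected c E' K' u v"
  unfolding rainbow_connected_def by (meson subset_trans)

lemma rainbow_connected_cong:
  assumes "rainbow_connected c E K u v" and "\<And>e. e \<in> E \<Longrightarrow> c' e = c e"
  shows "rainbow_connected c' E K u v"
proof -
  obtain F where F: "F \<subseteq> E" "inj_on c F" "c ` F \<subseteq> K" "(u, v) \<in> (adj F)\<^sup>*"
    using assms(1) by (auto simp: rainbow_connected_def)
  then have "inj_on c' F" "c' ` F \<subseteq> K"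
    using assms(2) by (auto simp: inj_on_def subset_iff)
  with F show ?thesis
    by (auto simp: rainbow_connected_def)
qed

text \<open>Disjoint colour sets keep \<open>c\<close> injective on the union of the two edge sets.
  The joined walk may repeat vertices, which does no harm.\<close>

lemma rainbow_connected_trans:
  assumes "rainbow_connected c E K u v" and "rainbow_connected c E L v w" and "K \<inter> L = {}"
  shows "rainbow_connected c E (K \<union> L) u w"
proof -
  obtain F where F: "F \<subseteq> E" "inj_on c F" "c ` F \<subseteq> K" "(u, v) \<in> (adj F)\<^sup>*"
    using assms(1) by (auto simp: rainbow_connected_def)
  obtain G where G: "G \<subseteq> E" "inj_on c G" "c ` G \<subseteq> L" "(v, w) \<in> (adj G)\<^sup>*"
    using assms(2) by (auto simp: rainbow_connected_def)
  have "inj_on c (F \<union> G)"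
    using F(2,3) G(2,3) assms(3) unfolding inj_on_Un by blast
  moreover have "(u, w) \<in> (adj (F \<union> G))\<^sup>*"
    using adj_rtrancl_mono[OF F(4), of "F \<union> G"] adj_rtrancl_mono[OF G(4), of "F \<union> G"]
    by (meson rtrancl_trans sup_ge1 sup_ge2)
  ultimately show ?thesis
    using F(1,3) G(1,3) unfolding rainbow_connected_def by (intro exI[of _ "F \<union> G"]) auto
qed

lemma rainbow_connected_imp_reachable:
  "rainbow_connected c E K u v \<Longrightarrow> (u, v) \<in> (adj E)\<^sup>*"
  by (auto simp: rainbow_connected_def intro: adj_rtrancl_mono)

section \<open>From walks to rainbow paths in the graph\<close>

lemma path_edges_append:
  "path_edges (xs @ y # ys) = path_edges (xs @ [y]) @ path_edges (y # ys)"
  by (induction xs rule: path_edges.induct) (auto split: list.splits)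

text \<open>The path is built from its end backwards: if the vertex to be prepended already occurs,
  everything before its occurrence is dropped.\<close>

lemma reachable_imp_path_between:
  assumes "(u, v) \<in> (adj F)\<^sup>*" and "v \<in> V" and "F \<subseteq> Pow V"
  shows "\<exists>p. path_between V F u p v"
  using assms(1)
proof (induction rule: converse_rtrancl_induct)
  case base
  then show ?case
    using assms(2) by (auto simp: path_between_def intro!: exI[of _ "[v]"])
next
  case (step u w)
  then obtain p where p: "path_between V F w p v"
    by blast
  show ?case
  proof (cases "u \<in> set p")
    case True
    then obtain ys zs where "p = ys @ u # zs"
      by (meson split_list)
    then have "path_between V F u (u # zs) v"
      using p path_edges_append[of ys u zs] by (auto simp: path_between_def)
    then show ?thesis
      by blast
  next
    case False
    have "p = w # tl p"
      using p by (auto simp: path_between_def)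
    then have "path_between V F u (u # p) v"
      using p False step.hyps(1) assms(3)
      by (cases p) (auto simp: path_between_def)
    then show ?thesis
      by blast
  qed
qed

lemma rainbow_connected_imp_rainbow_path:
  assumes "rainbow_connected c E K u v" and "v \<in> V" and "E \<subseteq> Pow V"
  shows "\<exists>p. rainbow_path c V E u p v"
proof -
  obtain F where F: "F \<subseteq> E" "inj_on c F" "(u, v) \<in> (adj F)\<^sup>*"
    using assms(1) by (auto simp: rainbow_connected_def)
  then obtain p where "path_between V F u p v"
    using reachable_imp_path_between[OF F(3) assms(2)] assms(3) by blast
  then have "rainbow_path c V E u p v"
    using F(1,2) unfolding rainbow_path_def path_between_def
    by (auto simp: distinct_map distinct_path_edges intro: inj_on_subset)
  then show ?thesis ..
qed

text \<open>The colours lie below \<open>r\<close>, so that \<open>r\<close> is fresh for the next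
  extension. The connecting edges lie inside \<open>D\<close>, so that recolouring other edges does
  not disturb them.\<close>

definition rainbow_on :: "('a set \<Rightarrow> nat) \<Rightarrow> nat \<Rightarrow> 'a set set \<Rightarrow> 'a set \<Rightarrow> bool" where
  "rainbow_on c r E D \<longleftrightarrow> c ` induced_edges E D \<subseteq> {..<r} \<and>
     (\<forall>u\<in>D. \<forall>v\<in>D. rainbow_connected c (induced_edges E D) {..<r} u v)"

lemma rainbow_on_imp_rainbow_connection_number_le:
  assumes "simple_graph V E" and "rainbow_on c r E V"
  shows "rainbow_connection_number V E \<le> r"
proof -
  have EV: "E \<subseteq> Pow V" "induced_edges E V = E"
    using assms(1) by (auto simp: simple_graph_def induced_edges_def)
  have "rainbow_colouring c V E"
    unfolding rainbow_colouring_def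
  proof (intro ballI)
    fix u v assume "u \<in> V" "v \<in> V"
    then show "\<exists>p. rainbow_path c V E u p v"
      using assms(2) EV by (intro rainbow_connected_imp_rainbow_path) (auto simp: rainbow_on_def)
  qed
  then have "rainbow_connection_number V E \<le> card (c ` E)"
    unfolding rainbow_connection_number_def by (intro Least_le) blast
  also have "\<dots> \<le> card {..<r}"
    using assms(2) by (intro card_mono) (auto simp: rainbow_on_def EV(2))
  finally show ?thesis
    by simp
qed

text \<open>The fresh colour \<open>r\<close> goes to every edge not contained in \<open>D\<close>.
  A vertex of \<open>Q\<close> enters \<open>D\<close> by one such edge and continues with old
  colours; two distinct vertices of \<open>Q\<close> are joined by a single edge.\<close>

lemma rainbow_on_extend:
  assumes D: "rainbow_on c r E D"
    and nbr: "\<And>q. q \<in> Q \<Longrightarrow> \<exists>d\<in>D. {q, d} \<in> E"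
    and disj: "Q \<inter> D = {}"
    and clique: "\<And>x y. x \<in> Q \<Longrightarrow> y \<in> Q \<Longrightarrow> x \<noteq> y \<Longrightarrow> {x, y} \<in> E"
  shows "\<exists>c'. rainbow_on c' (Suc r) E (D \<union> Q)"
proof -
  define c' where "c' e = (if e \<subseteq> D then c e else r)" for e
  let ?E = "induced_edges E (D \<union> Q)"
  have DD: "rainbow_connected c' ?E {..<r} u v" if "u \<in> D" "v \<in> D" for u v
  proof -
    have "rainbow_connected c' (induced_edges E D) {..<r} u v"
      by (rule rainbow_connected_cong[of c]) (use D that in \<open>auto simp: rainbow_on_def c'_def\<close>)
    then show ?thesis
      by (rule rainbow_connected_mono) auto
  qed
  have new: "rainbow_connected c' ?E {r} x y" if "{x, y} \<in> E" "x \<in> Q" "y \<in> D \<union> Q" for x y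
    using that disj by (intro rainbow_connected_edge) (auto simp: c'_def)
  have Suc_r: "{r} \<union> {..<r} = {..<Suc r}"
    by auto
  have QD: "rainbow_connected c' ?E {..<Suc r} q v" if q: "q \<in> Q" and v: "v \<in> D" for q v
  proof -
    obtain d where d: "d \<in> D" "{q, d} \<in> E"
      using nbr q by blast
    show ?thesis
      using rainbow_connected_trans[OF new[OF d(2) q] DD[OF d(1) v]] d(1) Suc_r by auto
  qed
  have QQ: "rainbow_connected c' ?E {..<Suc r} x y" if "x \<in> Q" "y \<in> Q" for x y
  proof (cases "x = y")
    case False
    then have "rainbow_connected c' ?E {r} x y"
      using that clique new by simp
    then show ?thesis
      by (rule rainbow_connected_mono) auto
  qed (simp add: rainbow_connected_refl)
  have DD': "rainbow_connected c' ?E {..<Suc r} u v" if "u \<in> D" "v \<in> D" for u v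
    using DD[OF that] by (rule rainbow_connected_mono) auto
  have "c' ` ?E \<subseteq> {..<Suc r}"
    using D by (fastforce simp: c'_def rainbow_on_def)
  then have "rainbow_on c' (Suc r) E (D \<union> Q)"
    unfolding rainbow_on_def using DD' QQ QD by (metis UnE rainbow_connected_sym)
  then show ?thesis
    by blast
qed

section \<open>Extending a rainbow colouring from a dominating set\<close>

lemma maximal_subset:
  assumes "finite S" and "P X\<^sub>0" and "\<And>X. P X \<Longrightarrow> X \<subseteq> S"
  obtains X where "P X" and "\<And>Y. P Y \<Longrightarrow> X \<subseteq> Y \<Longrightarrow> Y = X"
proof -
  have "finite (Collect P)"
    using assms(1,3) by (auto intro: finite_subset[of _ "Pow S"])
  then have "\<exists>X\<in>Collect P. \<forall>Y\<in>Collect P. X \<subseteq> Y \<longrightarrow> X = Y"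
    using assms(2) by (intro finite_has_maximal) auto
  then show thesis
    using that by auto
qed

lemma maximal_independent_set:
  assumes "finite S" and "\<And>x. x \<in> S \<Longrightarrow> {x} \<notin> E"
  obtains X where "X \<subseteq> S" and "\<And>x y. x \<in> X \<Longrightarrow> y \<in> X \<Longrightarrow> {x, y} \<notin> E"
    and "\<And>y. y \<in> S - X \<Longrightarrow> \<exists>x\<in>X. {y, x} \<in> E"
proof -
  let ?I = "\<lambda>X. X \<subseteq> S \<and> (\<forall>x\<in>X. \<forall>y\<in>X. {x, y} \<notin> E)"
  obtain X where X: "?I X" and max: "\<And>Y. ?I Y \<Longrightarrow> X \<subseteq> Y \<Longrightarrow> Y = X"
    by (rule maximal_subset[of S ?I "{}"]) (use assms(1) in auto)
  have "\<exists>x\<in>X. {y, x} \<in> E" if y: "y \<in> S - X" for y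
  proof (rule ccontr)
    assume none: "\<not> (\<exists>x\<in>X. {y, x} \<in> E)"
    \<comment> \<open>Independence also speaks of equal vertices, so the absence of a loop at
      \<open>y\<close> is needed here.\<close>
    have "?I (insert y X)"
      using X y none assms(2) by (auto simp: insert_commute)
    then show False
      using max[of "insert y X"] y by auto
  qed
  with X show thesis
    by (intro that[of X]) auto
qed

text \<open>Outside \<open>D\<close>, let \<open>X\<close> be a maximal independent set and \<open>Y\<close> its complement. The edges from
  \<open>X\<close> to \<open>D\<close> get colour \<open>r\<close>, those from \<open>Y\<close> to \<open>D\<close> colour \<open>r + 1\<close> and those avoiding \<open>D\<close>
  colour \<open>r + 2\<close>. A vertex \<open>z\<close> of \<open>X\<close> all of whose neighbours are in \<open>D\<close> instead keeps colour
  \<open>r\<close> for one edge \<open>{z, f z}\<close> only. Thus every vertex of \<open>X\<close> reaches \<open>D\<close> both with \<open>r\<close> alone and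
  with \<open>r + 1\<close> and \<open>r + 2\<close>, and symmetrically for \<open>Y\<close>.\<close>

lemma rainbow_on_dominating:
  assumes fin: "finite V" and D: "rainbow_on c r E D" and DV: "D \<subseteq> V"
    and loopfree: "\<And>x. {x} \<notin> E"
    and EV: "E \<subseteq> Pow V"
    and dom: "\<And>v. v \<in> V - D \<Longrightarrow> \<exists>d\<in>D. {v, d} \<in> E"
    and deg: "\<And>v w. v \<in> V - D \<Longrightarrow> \<exists>w'\<in>V. w' \<noteq> w \<and> {v, w'} \<in> E"
  shows "\<exists>c'. rainbow_on c' (r + 3) E V"
proof -
  obtain X where X: "X \<subseteq> V - D" and indep: "\<And>x y. x \<in> X \<Longrightarrow> y \<in> X \<Longrightarrow> {x, y} \<notin> E"
    and maxi: "\<And>y. y \<in> V - D - X \<Longrightarrow> \<exists>x\<in>X. {y, x} \<in> E"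
    using maximal_independent_set[of "V - D" E] fin loopfree by blast
  define Y where "Y = V - D - X"
  define Z where "Z = {z\<in>X. \<forall>y\<in>Y. {z, y} \<notin> E}"
  obtain f where f: "\<And>v. v \<in> V - D \<Longrightarrow> f v \<in> D \<and> {v, f v} \<in> E"
    using dom by metis
  define c' where "c' e = (if e \<subseteq> D then c e else if e \<inter> D = {} then r + 2
    else if e \<inter> Y \<noteq> {} \<or> (\<exists>z\<in>Z. z \<in> e \<and> f z \<notin> e) then r + 1 else r)" for e
  have ind: "induced_edges E V = E"
    using EV by (auto simp: induced_edges_def)
  let ?rc = "rainbow_connected c' E"
  have DD: "?rc {..<r} u v" if "u \<in> D" "v \<in> D" for u v
  proof -
    have "rainbow_connected c' (induced_edges E D) {..<r} u v"
      by (rule rainbow_connected_cong[of c]) (use D that in \<open>auto simp: rainbow_on_def c'_def\<close>)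
    then show ?thesis
      by (rule rainbow_connected_mono) auto
  qed
  have X1: "\<exists>d\<in>D. ?rc {r} x d" if "x \<in> X" for x
  proof -
    have "f x \<in> D" "{x, f x} \<in> E"
      using f that X by blast+
    \<comment> \<open>This holds for \<open>x\<close> in \<open>Z\<close> as well: the clause for
      \<open>Z\<close> exempts the edge that contains \<open>f x\<close>.\<close>
    moreover from this have "c' {x, f x} = r"
      using that X DV by (auto simp: c'_def Y_def Z_def)
    ultimately show ?thesis
      by (auto intro!: bexI[of _ "f x"] rainbow_connected_edge)
  qed
  have Y1: "\<exists>d\<in>D. ?rc {r + 1} y d" if "y \<in> Y" for y
  proof -
    have "f y \<in> D" "{y, f y} \<in> E"
      using f that by (auto simp: Y_def)
    moreover from this have "c' {y, f y} = r + 1"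
      using that by (auto simp: c'_def Y_def)
    ultimately show ?thesis
      by (auto intro!: bexI[of _ "f y"] rainbow_connected_edge)
  qed
  have XY: "?rc {r + 2} x y" if "x \<in> X" "y \<in> Y" "{x, y} \<in> E" for x y
    using that X by (intro rainbow_connected_edge) (auto simp: c'_def Y_def)
  have X2: "\<exists>d\<in>D. ?rc {r + 1, r + 2} x d" if x: "x \<in> X" for x
  proof (cases "x \<in> Z")
    case True
    \<comment> \<open>All neighbours of \<open>x\<close> lie in \<open>D\<close>, so the degree
      condition supplies one other than \<open>f x\<close>; its edge has colour
      \<open>r + 1\<close>.\<close>
    obtain w where w: "w \<in> V" "w \<noteq> f x" "{x, w} \<in> E"
      using deg[of x "f x"] x X by blast
    then have "w \<in> D"
      using True indep x by (auto simp: Z_def Y_def)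
    moreover have "c' {x, w} = r + 1"
    proof -
      have "x \<notin> D" "f x \<in> D"
        using f x X by blast+
      then have "f x \<notin> {x, w}"
        using w(2) by auto
      then have "\<exists>z\<in>Z. z \<in> {x, w} \<and> f z \<notin> {x, w}"
        using True by (intro bexI[of _ x]) auto
      then show ?thesis
        using \<open>x \<notin> D\<close> \<open>w \<in> D\<close> unfolding c'_def by simp
    qed
    ultimately show ?thesis
      using w(3) by (auto intro!: bexI[of _ w] rainbow_connected_edge)
  next
    case False
    \<comment> \<open>The detour through a neighbour in \<open>Y\<close> uses \<open>r + 2\<close>,
      then \<open>r + 1\<close>.\<close>
    then obtain y where y: "y \<in> Y" "{x, y} \<in> E"
      using x by (auto simp: Z_def)
    obtain d where d: "d \<in> D" "?rc {r + 1} y d"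
      using Y1 y(1) by blast
    have "?rc ({r + 2} \<union> {r + 1}) x d"
      using rainbow_connected_trans[OF XY[OF x y] d(2)] by simp
    with d(1) show ?thesis
      by (auto simp: insert_commute)
  qed
  have Y2: "\<exists>d\<in>D. ?rc {r, r + 2} y d" if y: "y \<in> Y" for y
  proof -
    \<comment> \<open>Maximality of \<open>X\<close> gives a neighbour in \<open>X\<close>; the
      route uses \<open>r + 2\<close>, then \<open>r\<close>.\<close>
    obtain x where x: "x \<in> X" "{y, x} \<in> E"
      using maxi y by (auto simp: Y_def)
    obtain d where d: "d \<in> D" "?rc {r} x d"
      using X1 x(1) by blast
    have "?rc {r + 2} y x"
      using XY[OF x(1) y] x(2) by (auto simp: insert_commute intro: rainbow_connected_sym)
    then have "?rc ({r + 2} \<union> {r}) y d"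
      using rainbow_connected_trans[OF _ d(2)] by simp
    with d(1) show ?thesis
      by (auto simp: insert_commute)
  qed
  \<comment> \<open>Both ends reach \<open>D\<close> with disjoint sets of new colours, and the
    colours below \<open>r\<close> bridge the gap inside \<open>D\<close>.\<close>
  have via_D: "?rc {..<r + 3} u v"
    if u: "\<exists>d\<in>D. ?rc K u d" and v: "\<exists>d\<in>D. ?rc L v d"
      and KL: "K \<inter> L = {}" "K \<union> L \<subseteq> {r..<r + 3}" for K L u v
  proof -
    obtain d where d: "d \<in> D" "?rc K u d"
      using u by blast
    obtain d' where d': "d' \<in> D" "?rc L v d'"
      using v by blast
    have "K \<inter> {..<r} = {}" "(K \<union> {..<r}) \<inter> L = {}"
      using KL by fastforce+
    then have "?rc (K \<union> {..<r} \<union> L) u v"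
      by (meson rainbow_connected_trans rainbow_connected_sym d d' DD)
    then show ?thesis
      by (rule rainbow_connected_mono) (use KL(2) in auto)
  qed
  have "?rc {..<r + 3} u v" if "u \<in> V" "v \<in> V" for u v
  proof -
    \<comment> \<open>Vertices of \<open>D\<close> spend no new colour; the empty colour set lets
      \<open>via_D\<close> treat all nine cases alike.\<close>
    have D0: "\<exists>d\<in>D. ?rc {} w d" if "w \<in> D" for w
      using that rainbow_connected_refl by metis
    have "w \<in> D \<or> w \<in> X \<or> w \<in> Y" if "w \<in> V" for w
      using that by (auto simp: Y_def)
    with that consider "u \<in> D" "v \<in> D" | "u \<in> D" "v \<in> X" | "u \<in> D" "v \<in> Y"
      | "u \<in> X" "v \<in> D" | "u \<in> X" "v \<in> X" | "u \<in> X" "v \<in> Y"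
      | "u \<in> Y" "v \<in> D" | "u \<in> Y" "v \<in> X" | "u \<in> Y" "v \<in> Y"
      by blast
    then show ?thesis
    proof cases
      case 1 then show ?thesis by (intro via_D[OF D0 D0]) auto
    next
      case 2 then show ?thesis by (intro via_D[OF D0 X1]) auto
    next
      case 3 then show ?thesis by (intro via_D[OF D0 Y1]) auto
    next
      case 4 then show ?thesis by (intro via_D[OF X1 D0]) auto
    next
      \<comment> \<open>Two vertices of \<open>X\<close> cannot both use \<open>r\<close>, so the
        second one takes its alternative route.\<close>
      case 5 then show ?thesis by (intro via_D[OF X1 X2]) auto
    next
      case 6 then show ?thesis by (intro via_D[OF X1 Y1]) auto
    next
      case 7 then show ?thesis by (intro via_D[OF Y1 D0]) auto
    next
      case 8 then show ?thesis by (intro via_D[OF Y1 X1]) auto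
    next
      case 9 then show ?thesis by (intro via_D[OF Y1 Y2]) auto
    qed
  qed
  moreover have "c' e < r + 3" if "e \<in> E" for e
  proof (cases "e \<subseteq> D")
    case True
    then have "c e < r"
      using D that by (auto simp: rainbow_on_def induced_edges_def)
    then show ?thesis
      using True by (simp add: c'_def)
  qed (simp add: c'_def)
  ultimately show ?thesis
    unfolding rainbow_on_def ind by blast
qed

section \<open>Separators in chordal graphs\<close>

text \<open>Chordless paths, encoded so that suffixes are again chordless and that prepending a
  vertex imposes conditions on this vertex only.\<close>

fun induced_path :: "'a set set \<Rightarrow> 'a list \<Rightarrow> bool" where
  "induced_path E (x # y # zs) \<longleftrightarrow> {x, y} \<in> E \<and> x \<notin> set (y # zs) \<and>
     (\<forall>z\<in>set zs. {x, z} \<notin> E) \<and> induced_path E (y # zs)"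
| "induced_path E _ \<longleftrightarrow> True"

lemma induced_path_append2: "induced_path E (xs @ ys) \<Longrightarrow> induced_path E ys"
proof (induction xs)
  case (Cons x xs)
  then show ?case
    by (cases "xs @ ys") auto
qed simp

lemma induced_path_distinct: "induced_path E p \<Longrightarrow> distinct p"
  by (induction p rule: path_edges.induct) auto

lemma reachable_imp_induced_path:
  assumes "(u, v) \<in> (adj (induced_edges E S))\<^sup>*" and "v \<in> S"
  shows "\<exists>p. induced_path E p \<and> p \<noteq> [] \<and> hd p = u \<and> last p = v \<and> set p \<subseteq> S"
  using assms(1)
proof (induction rule: converse_rtrancl_induct)
  case base
  then show ?case
    using assms(2) by (intro exI[of _ "[v]"]) auto
next
  case (step u w)
  then obtain p where p: "induced_path E p" "p \<noteq> []" "hd p = w" "last p = v" "set p \<subseteq> S"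
    by blast
  show ?case
  proof (cases "u \<in> set p")
    case True
    then obtain ys zs where "p = ys @ u # zs"
      by (meson split_list)
    then show ?thesis
      using p induced_path_append2[of E ys "u # zs"] by (intro exI[of _ "u # zs"]) auto
  next
    case False
    have "\<exists>x\<in>set p. {u, x} \<in> E"
      using step.hyps(1) p(2,3) by (intro bexI[of _ w]) auto
    \<comment> \<open>With \<open>x\<close> the last neighbour of \<open>u\<close> on the path, the
      suffix from \<open>x\<close> on can be preceded by \<open>u\<close> without creating a
      chord.\<close>
    then obtain ys x zs where x: "p = ys @ x # zs" "{u, x} \<in> E" "\<forall>z\<in>set zs. {u, z} \<notin> E"
      using split_list_last_prop[of p "\<lambda>x. {u, x} \<in> E"] by blast
    have "u \<in> S"
      using step.hyps(1) by simp
    with x show ?thesis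
      using p False induced_path_append2[of E ys "x # zs"]
      by (intro exI[of _ "u # x # zs"]) auto
  qed
qed

text \<open>For lack of chords, an edge through the first vertex must be the first edge of the path;
  induction treats the rest. Cardinality two excludes loops and the empty set.\<close>

lemma induced_path_induced_edges:
  assumes "induced_path E p" and "\<And>e. e \<in> E \<Longrightarrow> card e = 2"
  shows "induced_edges E (set p) = set (path_edges p)"
  using assms(1)
proof (induction p rule: path_edges.induct)
  case (1 x y zs)
  then have IH: "induced_edges E (set (y # zs)) = set (path_edges (y # zs))"
    by simp
  have "e = {x, y} \<or> e \<in> induced_edges E (set (y # zs))"
    if e: "e \<in> E" "e \<subseteq> set (x # y # zs)" for e
  proof (cases "x \<in> e")
    case True
    obtain a b where "e = {a, b}" "a \<noteq> b"
      using assms(2)[OF e(1)] by (meson card_2_iff)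
    then obtain b where b: "e = {x, b}" "b \<noteq> x"
      using True by auto
    then have "b = y"
      using e 1(2) by auto
    with b show ?thesis
      by simp
  qed (use e in auto)
  moreover have "{x, y} \<in> E"
    using 1(2) by simp
  ultimately have
    "induced_edges E (set (x # y # zs)) = insert {x, y} (induced_edges E (set (y # zs)))"
    unfolding induced_edges_def by fastforce
  with IH show ?case
    by simp
next
  case "2_1"
  then show ?case
    using assms(2)[of "{}"] by (auto simp: induced_edges_def)
next
  case ("2_2" v)
  have "e \<notin> E" if "e \<subseteq> {v}" for e
    using assms(2)[of e] card_mono[OF _ that] by auto
  then show ?case
    by (auto simp: induced_edges_def)
qed

lemma length_path_edges: "length (path_edges p) = length p - 1"
  by (induction p rule: path_edges.induct) auto

lemma nth_path_edges: "Suc i < length p \<Longrightarrow> path_edges p ! i = {p ! i, p ! Suc i}"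
proof (induction p arbitrary: i rule: path_edges.induct)
  case (1 x y zs)
  then show ?case
    by (cases i) auto
qed auto

text \<open>Repeating the head at the end replaces the modular index by a closed list, which can
  then be split into two paths.\<close>

lemma cycle_edges_eq:
  assumes "p \<noteq> []"
  shows "cycle_edges p = set (path_edges (p @ [hd p]))"
proof -
  have "path_edges (p @ [hd p]) ! i = {p ! i, p ! (Suc i mod length p)}" if "i < length p" for i
    using that assms
    by (cases "Suc i = length p") (auto simp: nth_path_edges nth_append hd_conv_nth)
  moreover have "length (path_edges (p @ [hd p])) = length p"
    by (simp add: length_path_edges)
  ultimately show ?thesis
    by (fastforce simp: cycle_edges_def set_conv_nth)
qed

text \<open>A walk from \<open>x\<close> into \<open>C\<close>, through \<open>C\<close> and out to
  \<open>y\<close> shortens to an induced path; as its ends are not adjacent, it has an inner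
  vertex.\<close>

lemma induced_path_through:
  assumes conn: "\<And>u v. u \<in> C \<Longrightarrow> v \<in> C \<Longrightarrow> (u, v) \<in> (adj (induced_edges E C))\<^sup>*"
    and xy: "x \<noteq> y" "{x, y} \<notin> E"
    and x: "\<exists>u\<in>C. {x, u} \<in> E" and y: "\<exists>v\<in>C. {y, v} \<in> E"
  obtains as where "induced_path E (x # as @ [y])" and "as \<noteq> []" and "set as \<subseteq> C"
proof -
  let ?S = "insert x (insert y C)"
  let ?R = "adj (induced_edges E ?S)"
  obtain u v where uv: "u \<in> C" "{x, u} \<in> E" "v \<in> C" "{y, v} \<in> E"
    using x y by blast
  have "(x, u) \<in> ?R" "(v, y) \<in> ?R"
    using uv by (auto simp: insert_commute)
  moreover have "(u, v) \<in> ?R\<^sup>*"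
    by (rule adj_rtrancl_mono[OF conn[OF uv(1,3)]]) auto
  ultimately have "(x, y) \<in> ?R\<^sup>*"
    by (meson converse_rtrancl_into_rtrancl rtrancl.rtrancl_into_rtrancl)
  then obtain p where p: "induced_path E p" "p \<noteq> []" "hd p = x" "last p = y" "set p \<subseteq> ?S"
    using reachable_imp_induced_path[of x y E ?S] by blast
  then obtain q where q: "p = x # q" "q \<noteq> []"
    using xy(1) by (cases p) (auto split: if_splits)
  then obtain as where as: "p = x # as @ [y]"
    using p(4) by (metis append_butlast_last_id last_ConsR)
  then have "as \<noteq> []"
    using p(1) xy(2) by auto
  moreover have "set as \<subseteq> C"
    using p(5) induced_path_distinct[OF p(1)] as by auto
  ultimately show thesis
    using that p(1) as by blast
qed

text \<open>If \<open>x\<close> and \<open>y\<close> were not adjacent, induced paths between them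
  through \<open>C\<close> and through \<open>D\<close> would close up to an induced cycle of length
  at least four.\<close>

lemma chordal_separator_clique:
  assumes G: "simple_graph V E" and ch: "chordal V E"
    and CV: "C \<subseteq> V" and DV: "D \<subseteq> V" and disj: "C \<inter> D = {}"
    and no_edge: "\<And>a b. a \<in> C \<Longrightarrow> b \<in> D \<Longrightarrow> {a, b} \<notin> E"
    and connC: "\<And>u v. u \<in> C \<Longrightarrow> v \<in> C \<Longrightarrow> (u, v) \<in> (adj (induced_edges E C))\<^sup>*"
    and connD: "\<And>u v. u \<in> D \<Longrightarrow> v \<in> D \<Longrightarrow> (u, v) \<in> (adj (induced_edges E D))\<^sup>*"
    and x: "x \<in> V - C - D" "\<exists>u\<in>C. {x, u} \<in> E" "\<exists>u\<in>D. {x, u} \<in> E"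
    and y: "y \<in> V - C - D" "\<exists>v\<in>C. {y, v} \<in> E" "\<exists>v\<in>D. {y, v} \<in> E"
    and "x \<noteq> y"
  shows "{x, y} \<in> E"
proof (rule ccontr)
  assume nE: "{x, y} \<notin> E"
  have card2: "card e = 2" if "e \<in> E" for e
    using G that by (auto simp: simple_graph_def)
  obtain as where as: "induced_path E (x # as @ [y])" "as \<noteq> []" "set as \<subseteq> C"
    using induced_path_through[OF connC \<open>x \<noteq> y\<close> nE x(2) y(2)] .
  have yx: "y \<noteq> x" "{y, x} \<notin> E"
    using \<open>x \<noteq> y\<close> nE by (auto simp: insert_commute)
  obtain bs where bs: "induced_path E (y # bs @ [x])" "bs \<noteq> []" "set bs \<subseteq> D"
    using induced_path_through[OF connD yx y(3) x(3)] .
  let ?p = "x # as @ y # bs"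
  have len: "length ?p > 3"
    using as(2) bs(2) by (cases as; cases bs) auto
  have dist: "distinct ?p"
    using induced_path_distinct[OF as(1)] induced_path_distinct[OF bs(1)] as(3) bs(3) disj
    by auto
  \<comment> \<open>An edge contained in neither of the two paths would join \<open>C\<close> to
    \<open>D\<close>.\<close>
  have split: "e \<subseteq> set (x # as @ [y]) \<or> e \<subseteq> set (y # bs @ [x])"
    if e: "e \<in> E" "e \<subseteq> set ?p" for e
  proof (rule ccontr)
    assume neg: "\<not> ?thesis"
    then obtain a b where ab: "a \<in> e" "b \<in> e" "a \<in> set as" "b \<in> set bs"
      using e(2) by auto
    then have "a \<noteq> b"
      using as(3) bs(3) disj by auto
    then have "e = {a, b}"
      using card2[OF e(1)] ab(1,2) by (auto simp: card_2_iff)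
    then show False
      using no_edge[of a b] ab(3,4) as(3) bs(3) e(1) by auto
  qed
  have "induced_edges E (set ?p)
      = induced_edges E (set (x # as @ [y])) \<union> induced_edges E (set (y # bs @ [x]))"
    using split by (auto simp: induced_edges_def)
  also have "\<dots> = set (path_edges (x # as @ [y])) \<union> set (path_edges (y # bs @ [x]))"
    using induced_path_induced_edges[OF as(1) card2] induced_path_induced_edges[OF bs(1) card2]
    by simp
  also have "\<dots> = set (path_edges (?p @ [hd ?p]))"
    using path_edges_append[of "x # as" y "bs @ [x]"] by simp
  also have "\<dots> = cycle_edges ?p"
    by (rule cycle_edges_eq[symmetric]) simp
  finally have "induced_cycle V E ?p"
    using len dist as(3) bs(3) CV DV x(1) y(1) unfolding induced_cycle_def by auto
  then show False
    using ch len unfolding chordal_def by blast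
qed

section \<open>Lower bounds drawn from vertex connectivity\<close>

lemma path_edges_imp_reachable:
  "p \<noteq> [] \<Longrightarrow> set (path_edges p) \<subseteq> F \<Longrightarrow> (hd p, last p) \<in> (adj F)\<^sup>*"
  by (induction p rule: path_edges.induct) (auto intro: converse_rtrancl_into_rtrancl)

lemma vertex_connected_card_separator:
  assumes "vertex_connected k V E" and QV: "Q \<subseteq> V" and C: "C \<subseteq> V - Q"
    and a: "a \<in> C" and b: "b \<in> V - Q - C"
    and closed: "\<And>u v. u \<in> C \<Longrightarrow> v \<in> V \<Longrightarrow> {u, v} \<in> E \<Longrightarrow> v \<in> C \<union> Q"
  shows "k \<le> card Q"
proof -
  let ?E = "induced_edges E (V - Q)"
  have "w \<in> C" if "(a, w) \<in> (adj ?E)\<^sup>*" for w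
    using that by (induction rule: rtrancl_induct) (use a closed in auto)
  then have "(a, b) \<notin> (adj ?E)\<^sup>*"
    using b by auto
  then have "\<not> path_between (V - Q) ?E a p b" for p
    using path_edges_imp_reachable[of p ?E] by (auto simp: path_between_def)
  then have "\<not> connected_graph (V - Q) ?E"
    using a b C unfolding connected_graph_def by blast
  then have "vertex_connectivity V E \<le> card Q"
    unfolding vertex_connectivity_def using QV by (intro Least_le) blast
  then show ?thesis
    using assms(1) by (simp add: vertex_connected_def)
qed

text \<open>The neighbours of \<open>v\<close> separate it from all remaining vertices. If none
  remain, deleting the neighbours leaves \<open>v\<close> alone, which the definition of
  connectivity admits as well.\<close>

lemma vertex_connected_degree:
  assumes G: "simple_graph V E" and k: "vertex_connected k V E" and v: "v \<in> V"
  shows "k \<le> card {w\<in>V. {v, w} \<in> E}"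
proof -
  let ?N = "{w\<in>V. {v, w} \<in> E}"
  have "{v} \<notin> E"
    using G by (auto simp: simple_graph_def)
  then have vN: "v \<notin> ?N"
    by simp
  show ?thesis
  proof (cases "V - ?N = {v}")
    case True
    have "vertex_connectivity V E \<le> card ?N"
      unfolding vertex_connectivity_def
      by (intro Least_le exI[of _ ?N]) (simp add: True)
    then show ?thesis
      using k by (simp add: vertex_connected_def)
  next
    case False
    then obtain b where "b \<in> V - ?N - {v}"
      using v vN by blast
    then show ?thesis
      using vertex_connected_card_separator[OF k, of ?N "{v}" v b] v vN by auto
  qed
qed

section \<open>Growing a dominating set\<close>

lemma chordal_grow:
  assumes G: "simple_graph V E" and ch: "chordal V E" and k: "vertex_connected k V E"
    and D: "rainbow_on c r E D" and DV: "D \<subseteq> V" and "D \<noteq> {}"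
    and v: "v \<in> V - D" "\<not> (\<exists>d\<in>D. {v, d} \<in> E)"
  obtains Q c' where "Q \<subseteq> V" and "Q \<inter> D = {}" and "k \<le> card Q"
    and "rainbow_on c' (Suc r) E (D \<union> Q)"
proof -
  define W where "W = {w\<in>V - D. \<not> (\<exists>d\<in>D. {w, d} \<in> E)}"
  define C where "C = {w. (v, w) \<in> (adj (induced_edges E W))\<^sup>*}"
  define Q where "Q = {q\<in>V - C. \<exists>u\<in>C. {q, u} \<in> E}"
  have "v \<in> W"
    using v by (simp add: W_def)
  have CW: "C \<subseteq> W"
  proof
    fix w assume "w \<in> C"
    then have "(v, w) \<in> (adj (induced_edges E W))\<^sup>*"
      by (simp add: C_def)
    then show "w \<in> W"
      by (induction rule: rtrancl_induct) (use \<open>v \<in> W\<close> in auto)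
  qed
  have CV: "C \<subseteq> V" and CD: "C \<inter> D = {}"
    using CW by (auto simp: W_def)
  have vC: "v \<in> C"
    by (simp add: C_def)
  have no_edge: "{a, b} \<notin> E" if "a \<in> C" "b \<in> D" for a b
    using that CW by (auto simp: W_def)
  \<comment> \<open>A walk from \<open>v\<close> inside \<open>W\<close> visits only vertices of
    \<open>C\<close>, so \<open>C\<close> is connected by its own edges.\<close>
  have reach: "(v, w) \<in> (adj (induced_edges E C))\<^sup>*" if "w \<in> C" for w
  proof -
    have "(v, w) \<in> (adj (induced_edges E W))\<^sup>*"
      using that by (simp add: C_def)
    then show ?thesis
    proof (induction rule: rtrancl_induct)
      case (step y z)
      then have "y \<in> C" "z \<in> C"
        unfolding C_def by (auto intro: rtrancl.rtrancl_into_rtrancl)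
      then have "(y, z) \<in> adj (induced_edges E C)"
        using step.hyps(2) by auto
      with step.IH show ?case
        by (rule rtrancl.rtrancl_into_rtrancl)
    qed simp
  qed
  have connC: "(a, b) \<in> (adj (induced_edges E C))\<^sup>*" if "a \<in> C" "b \<in> C" for a b
    using adj_rtrancl_sym[OF reach[OF that(1)]] reach[OF that(2)] by (rule rtrancl_trans)
  have connD: "(a, b) \<in> (adj (induced_edges E D))\<^sup>*" if "a \<in> D" "b \<in> D" for a b
    using D that unfolding rainbow_on_def by (metis rainbow_connected_imp_reachable)
  have QD: "Q \<inter> D = {}"
    using no_edge unfolding Q_def by (fastforce simp: doubleton_eq_iff insert_commute)
  \<comment> \<open>Without a neighbour in \<open>D\<close>, \<open>q\<close> would lie in
    \<open>W\<close> and hence, being adjacent to \<open>C\<close>, in \<open>C\<close>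
    itself.\<close>
  have nbr: "\<exists>d\<in>D. {q, d} \<in> E" if q: "q \<in> Q" for q
  proof (rule ccontr)
    assume "\<not> ?thesis"
    then have "q \<in> W"
      using q QD by (auto simp: Q_def W_def)
    moreover obtain u where u: "u \<in> C" "{q, u} \<in> E"
      using q by (auto simp: Q_def)
    ultimately have "(u, q) \<in> adj (induced_edges E W)"
      using CW by (auto simp: insert_commute)
    with u(1) have "q \<in> C"
      unfolding C_def by (auto intro: rtrancl.rtrancl_into_rtrancl)
    then show False
      using q by (simp add: Q_def)
  qed
  have clique: "{x, y} \<in> E" if "x \<in> Q" "y \<in> Q" "x \<noteq> y" for x y
  proof (rule chordal_separator_clique[OF G ch CV DV CD no_edge connC connD])
    show "x \<in> V - C - D" "y \<in> V - C - D" "\<exists>u\<in>C. {x, u} \<in> E" "\<exists>u\<in>C. {y, u} \<in> E"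
      using that QD by (auto simp: Q_def)
  qed (use that nbr in auto)
  obtain d where "d \<in> D"
    using \<open>D \<noteq> {}\<close> by blast
  have "k \<le> card Q"
  proof (rule vertex_connected_card_separator[OF k, of Q C v d])
    show "d \<in> V - Q - C"
      using \<open>d \<in> D\<close> DV QD CD by auto
    show "z \<in> C \<union> Q" if "y \<in> C" "z \<in> V" "{y, z} \<in> E" for y z
      using that by (auto simp: Q_def insert_commute[of z])
  qed (use CV vC in \<open>auto simp: Q_def\<close>)
  moreover obtain c' where "rainbow_on c' (Suc r) E (D \<union> Q)"
    using rainbow_on_extend[OF D nbr QD clique] by blast
  ultimately show thesis
    using that[of Q c'] QD by (auto simp: Q_def)
qed

text \<open>The invariant is \<open>k * r < card D\<close>: a single vertex needs no colour, and
  each new colour brings at least \<open>k\<close> new vertices. A maximal set with this invariant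
  satisfies \<open>P\<close>, since otherwise it could grow.\<close>

lemma rainbow_on_grow_maximal:
  assumes fin: "finite V" and "V \<noteq> {}" and "k \<ge> 1"
    and grow: "\<And>D c r. D \<subseteq> V \<Longrightarrow> D \<noteq> {} \<Longrightarrow> rainbow_on c r E D \<Longrightarrow> \<not> P D \<Longrightarrow>
      \<exists>Q c'. Q \<subseteq> V \<and> Q \<inter> D = {} \<and> k \<le> card Q \<and> rainbow_on c' (Suc r) E (D \<union> Q)"
    and loopfree: "\<And>x. {x} \<notin> E" "{} \<notin> E"
  obtains D c r where "D \<subseteq> V" and "P D" and "rainbow_on c r E D" and "k * r < card V"
proof -
  let ?A = "\<lambda>D. D \<subseteq> V \<and> D \<noteq> {} \<and> (\<exists>c r. rainbow_on c r E D \<and> k * r < card D)"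
  obtain v where v: "v \<in> V"
    using assms(2) by blast
  have "induced_edges E {v} = {}"
    using loopfree by (auto simp: induced_edges_def subset_singleton_iff)
  then have "rainbow_on (\<lambda>_. 0) 0 E {v}"
    by (simp add: rainbow_on_def rainbow_connected_refl)
  then have "?A {v}"
    using v by (intro conjI exI[of _ "\<lambda>_. 0"] exI[of _ 0]) auto
  then obtain D where D: "?A D" and max: "\<And>D'. ?A D' \<Longrightarrow> D \<subseteq> D' \<Longrightarrow> D' = D"
    by (rule maximal_subset[OF fin, of ?A]) blast+
  then obtain c r where cr: "rainbow_on c r E D" "k * r < card D"
    by blast
  have "P D"
  proof (rule ccontr)
    assume "\<not> P D"
    then obtain Q c' where Q: "Q \<subseteq> V" "Q \<inter> D = {}" "k \<le> card Q" "rainbow_on c' (Suc r) E (D \<union> Q)"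
      using grow[OF _ _ cr(1)] D by blast
    have "finite D" "finite Q"
      using D Q(1) fin by (auto intro: finite_subset)
    then have "card (D \<union> Q) = card D + card Q"
      using Q(2) by (intro card_Un_disjoint) auto
    then have "k * Suc r < card (D \<union> Q)"
      using cr(2) Q(3) by simp
    then have "?A (D \<union> Q)"
      using D Q(1,4) by blast
    then have "Q = {}"
      using max[of "D \<union> Q"] Q(2) by blast
    then show False
      using Q(3) \<open>k \<ge> 1\<close> by simp
  qed
  moreover have "card D \<le> card V"
    using D fin by (intro card_mono) auto
  ultimately show thesis
    using that[of D c r] D cr by auto
qed

theorem theorem2:
  fixes V :: "'a set" and E :: "'a set set" and \<kappa> :: nat
  assumes "simple_graph V E"
    and "chordal V E"
    and "\<kappa> \<ge> 1"
    and "vertex_connected \<kappa> V E"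
  shows "real (rainbow_connection_number V E) \<le> real (card V) / real \<kappa> + 3"
proof -
  have conn: "connected_graph V E"
    using vertex_connected_imp_connected assms by blast
  then have V: "finite V" "V \<noteq> {}" and EV: "E \<subseteq> Pow V" and loopfree: "\<And>x. {x} \<notin> E" "{} \<notin> E"
    using assms(1) by (auto simp: simple_graph_def connected_graph_def)
  \<comment> \<open>One form serves both cases: for \<open>\<kappa> = 1\<close> the colouring itself
    has only \<open>r\<close> colours, otherwise three are added outside the dominating set.\<close>
  obtain r where r: "\<kappa> * r < card V" "rainbow_connection_number V E \<le> r + 3"
  proof (cases "\<kappa> = 1")
    case True
    obtain D c r where "D \<subseteq> V" "D = V" "rainbow_on c r E D" "\<kappa> * r < card V"
    proof (rule rainbow_on_grow_maximal[OF V \<open>\<kappa> \<ge> 1\<close> _ loopfree, where P = "\<lambda>D. D = V"])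
      fix D c r
      assume D: "D \<subseteq> V" "D \<noteq> {}" "rainbow_on c r E D" "D \<noteq> V"
      \<comment> \<open>Otherwise the empty set would separate \<open>D\<close> from the
        rest.\<close>
      have "\<exists>q\<in>V - D. \<exists>d\<in>D. {q, d} \<in> E"
      proof (rule ccontr)
        assume none: "\<not> ?thesis"
        obtain a b where ab: "a \<in> D" "b \<in> V - D"
          using D by blast
        then have "1 \<le> card ({} :: 'a set)"
          using vertex_connected_card_separator[OF assms(4), of "{}" D a b] D(1) none True
          by (fastforce simp: insert_commute)
        then show False
          by simp
      qed
      then obtain q where q: "q \<in> V - D" "\<exists>d\<in>D. {q, d} \<in> E"
        by blast
      \<comment> \<open>A single vertex is trivially a clique, so chordality does not enter this
        case.\<close>
      have "\<exists>c'. rainbow_on c' (Suc r) E (D \<union> {q})"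
        using q by (intro rainbow_on_extend[OF D(3)]) auto
      then show "\<exists>Q c'. Q \<subseteq> V \<and> Q \<inter> D = {} \<and> \<kappa> \<le> card Q \<and> rainbow_on c' (Suc r) E (D \<union> Q)"
        using q True by (intro exI[of _ "{q}"]) auto
    qed
    then show ?thesis
      using that rainbow_on_imp_rainbow_connection_number_le[OF assms(1)]
      by (metis trans_le_add1)
  next
    case False
    then have "\<kappa> \<ge> 2"
      using assms(3) by simp
    obtain D c r where D: "D \<subseteq> V" "\<forall>v\<in>V - D. \<exists>d\<in>D. {v, d} \<in> E" "rainbow_on c r E D"
      "\<kappa> * r < card V"
    proof (rule rainbow_on_grow_maximal[OF V \<open>\<kappa> \<ge> 1\<close> _ loopfree,
          where P = "\<lambda>D. \<forall>v\<in>V - D. \<exists>d\<in>D. {v, d} \<in> E"])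
      fix D c r
      assume D: "D \<subseteq> V" "D \<noteq> {}" "rainbow_on c r E D" "\<not> (\<forall>v\<in>V - D. \<exists>d\<in>D. {v, d} \<in> E)"
      then obtain v where v: "v \<in> V - D" "\<not> (\<exists>d\<in>D. {v, d} \<in> E)"
        by blast
      show "\<exists>Q c'. Q \<subseteq> V \<and> Q \<inter> D = {} \<and> \<kappa> \<le> card Q \<and> rainbow_on c' (Suc r) E (D \<union> Q)"
        by (rule chordal_grow[OF assms(1,2,4) D(3,1,2) v]) blast
    qed
    \<comment> \<open>The degree of \<open>v\<close> is at least \<open>\<kappa>\<close>, hence at
      least two, so some neighbour differs from \<open>w\<close>.\<close>
    have deg: "\<exists>w'\<in>V. w' \<noteq> w \<and> {v, w'} \<in> E" if "v \<in> V - D" for v w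
    proof (rule ccontr)
      assume "\<not> ?thesis"
      then have "{w\<in>V. {v, w} \<in> E} \<subseteq> {w}"
        by blast
      then have "card {w\<in>V. {v, w} \<in> E} \<le> card {w}"
        by (intro card_mono) auto
      then show False
        using vertex_connected_degree[OF assms(1,4), of v] that \<open>\<kappa> \<ge> 2\<close> by simp
    qed
    obtain c' where "rainbow_on c' (r + 3) E V"
      using rainbow_on_dominating[OF V(1) D(3,1) loopfree(1) EV _ deg] D(2) by blast
    then show ?thesis
      using that D(4) rainbow_on_imp_rainbow_connection_number_le[OF assms(1)] by blast
  qed
  have "real \<kappa> * real r \<le> real (card V)"
    using r(1) by (metis less_imp_le of_nat_le_iff of_nat_mult)
  then have "real r \<le> real (card V) / real \<kappa>"
    using assms(3) by (simp add: field_simps)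
  then show ?thesis
    using r(2) by linarith
qed

end
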